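(* The $\mathbf{cd}$-indexes $\check\Phi(n,k,i)$ of the simplicial shelling components satisfy, for all $0\le i\le k\le n$, the recursion $$G(\check\Phi(n,k,i))=\check\Phi(n+1,k+1,i+1)$$ with the boundary conditions $$\check\Phi(n,k,0)=\Psi(B_k)\cdot\Psi(\Omega_{n-k+1})\qquad\text{for }1\le k\le n,$$ and $$\check\Phi(n,0,0)=\begin{cases}(\mathbf c^2-2\mathbf d)^{n/2}&\text{if } n\text{ is even},\\(\mathbf c^2-2\mathbf d)^{(n-1)/2}\cdot\mathbf c&\text{if } n\text{ is odd}.\end{cases}$$
   Context: A quasi-graded poset $(P,\rho,\bar\zeta)$ consists of a finite poset $P$, a function $\rho:P\to\mathbb N$ with $x<y\Rightarrow\rho(x)<\rho(y)$, and a function $\bar\zeta$ in the incidence algebra of $P$ with $\bar\zeta(x,x)=1$. Write $\rho(x,y)=\rho(y)-\rho(x)$. If $P$ has minimal element $\hat0$ and maximal element $\hat1$, $\hat0<\hat1$, its $\mathbf{ab}$-index is the polynomial in non-commuting variables $\mathbf a,\mathbf b$ $$\Psi(P)=\sum\bar\zeta(x_0,x_1)\cdots\bar\zeta(x_{k-1},x_k)\cdot(\mathbf a-\mathbf b)^{\rho(x_0,x_1)-1}\,\mathbf b\,(\mathbf a-\mathbf b)^{\rho(x_1,x_2)-1}\,\mathbf b\cdots\mathbf b\,(\mathbf a-\mathbf b)^{\rho(x_{k-1},x_k)-1},$$ summed over all chains $\hat0=x_0<x_1<\cdots<x_k=\hat1$. Put $\mathbf c=\mathbf a+\mathbf b$,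 $\mathbf d=\mathbf a\mathbf b+\mathbf b\mathbf a$. $G$ is the linear derivation on non-commutative polynomials in $\mathbf a,\mathbf b$ with $G(\mathbf a)=\mathbf b\mathbf a$, $G(\mathbf b)=\mathbf a\mathbf b$; it satisfies $G(\mathbf c)=\mathbf d$, $G(\mathbf d)=\mathbf c\mathbf d$. Semisuspension. For a finite simplicial complex $\Delta$ (containing $\emptyset$) with $\dim\Delta<n$, $\mathrm{Semi}(\Delta,n)$ is obtained by embedding $\Delta$ in the boundary of an $n$-ball; its face poset $\mathcal F(\mathrm{Semi}(\Delta,n))$ is the following quasi-graded poset, independent of the embedding: the elements are the faces of $\Delta$ (with $\hat0=\emptyset$) and two further elements $*$ and $\hat1$; $\rho(F)=\dim F+1$, $\rho( * )=n$, $\rho(\hat1)=n+1$; faces are ordered by inclusion, every other element is $<\hat1$, and $F<*$ for every face $F$ with $\rho(F)<n$ (faces of dimension $n-1$ are incomparable to $*$); $$\bar\zeta(F,* )=1+(-1)^{n-\rho(F)}\,\widetilde\chi(\mathrm{link}_\Delta(F)),\qquad\widetilde\chi(\mathrm{link}_\Delta(F))=\sum_{H\in\Delta,\,H\supseteq F}(-1)^{\dim H-\dim F-1},$$ and $\bar\zeta=1$ on all other intervals. (For $n=0$, where $\Delta=\{\emptyset\}$, the element $*$ is omitted.) For $0\le i\le k$, $\Delta_{k,i}$ is the simplicial complex generated by $i+1$ of the facets of the $k$-dimensional simplex (so $\dim\Delta_{k,i}=k-1$, and $\Delta_{0,0}=\{\emptyset\}$). For $0\le i\le k\le n$ let $P_{n,k,i}=\mathcal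 F(\mathrm{Semi}(\Delta_{k,i},n))$, and define $\check\Phi(n,k,0)=\Psi(P_{n,k,0})$ and $\check\Phi(n,k,i)=\Psi(P_{n,k,i})-\Psi(P_{n,k,i-1})$ for $1\le i\le k\le n$. $B_k$ is the Boolean algebra of rank $k$ with its usual rank function and $\bar\zeta\equiv1$. For $m\ge1$, $\Psi(\Omega_m)$ is the $\mathbf{ab}$-index of the quasi-graded poset $\{\hat0,p,c,\hat1\}$ with ranks $0,1,m,m+1$, ordered as the chain $\hat0<p<c<\hat1$ if $m\ge2$ and with $p,c$ incomparable if $m=1$, with $\bar\zeta(p,c)=1+(-1)^m$ (if $m\ge2$) and $\bar\zeta=1$ on all other intervals. *)

theory Defs
  imports Main "HOL-Library.Poly_Mapping"
begin

section \<open>Polynomials in the non-commuting variables a and b\<close>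

datatype letter = LA | LB

text \<open>
  Words are wrapped in a type of their own, with concatenation written additively, so that
  \<open>abword \<Rightarrow>\<^sub>0 int\<close> with the convolution product is the free ring on a and b.
\<close>

datatype abword = Word (letters: "letter list")

instantiation abword :: monoid_add
begin
definition zero_abword :: abword where "0 = Word []"
definition plus_abword :: "abword \<Rightarrow> abword \<Rightarrow> abword"
  where "u + v = Word (letters u @ letters v)"
instance by standard (auto simp: zero_abword_def plus_abword_def)
end

type_synonym abpoly = "abword \<Rightarrow>\<^sub>0 int"

definition var_a :: abpoly where "var_a = frag_of (Word [LA])"
definition var_b :: abpoly where "var_b = frag_of (Word [LB])"
definition var_c :: abpoly where "var_c = var_a + var_b"
definition var_d :: abpoly where "var_d = var_a * var_b + var_b * var_a"

section \<open>The derivation G\<close>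

text \<open>Over the integers, linear means additive.\<close>

definition is_derivation :: "(abpoly \<Rightarrow> abpoly) \<Rightarrow> bool" where
  "is_derivation D \<longleftrightarrow>
     (\<forall>p q. D (p + q) = D p + D q) \<and> (\<forall>p q. D (p * q) = D p * q + p * D q)"

fun G_letter :: "letter \<Rightarrow> abpoly" where
  "G_letter LA = var_b * var_a"
| "G_letter LB = var_a * var_b"

fun G_word :: "letter list \<Rightarrow> abpoly" where
  "G_word [] = 0"
| "G_word (x # w) = G_letter x * frag_of (Word w) + frag_of (Word [x]) * G_word w"

definition G :: "abpoly \<Rightarrow> abpoly" where
  "G = frag_extend (\<lambda>w. G_word (letters w))"

lemma frag_of_mult: "frag_of u * frag_of v = frag_of (u + v :: abword)"
  by (simp add: mult_single)

lemma G_add: "G (p + q) = G p + G q"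
  by (simp add: G_def frag_extend_add)

lemma G_diff: "G (p - q) = G p - G q"
  by (simp add: G_def frag_extend_diff)

lemma G_zero [simp]: "G 0 = 0"
  by (simp add: G_def)

lemma G_frag_of [simp]: "G (frag_of w) = G_word (letters w)"
  by (simp add: G_def)

lemma G_word_append:
  "G_word (u @ v) = G_word u * frag_of (Word v) + frag_of (Word u) * G_word v"
proof (induction u)
  case Nil
  have "frag_of (Word []) = (1 :: abpoly)"
    using single_one[where 'a = abword and 'b = int] by (simp add: zero_abword_def)
  then show ?case by simp
next
  case (Cons x u)
  have 1: "frag_of (Word (u @ v)) = (frag_of (Word u) * frag_of (Word v) :: abpoly)"
    by (simp only: frag_of_mult) (simp add: plus_abword_def)
  have 2: "frag_of (Word (x # u)) = (frag_of (Word [x]) * frag_of (Word u) :: abpoly)"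
    by (simp only: frag_of_mult) (simp add: plus_abword_def)
  show ?case
    by (simp only: append_Cons G_word.simps Cons.IH 1 2) (simp only: algebra_simps)
qed

lemma G_mult: "G (p * q) = G p * q + p * G q"
proof -
  have word: "G (frag_of u * q) = G (frag_of u) * q + frag_of u * G q" for u
    by (rule frag_induction[of q UNIV])
      (simp_all add: frag_of_mult plus_abword_def G_word_append G_diff algebra_simps
        del: mult_single)
  show ?thesis
    by (rule frag_induction[of p UNIV]) (simp_all add: word G_diff left_diff_distrib right_diff_distrib)
qed

text \<open>G is the unique derivation with the prescribed values on the two variables.\<close>

lemma G_derivation: "is_derivation G"
  by (simp add: is_derivation_def G_add G_mult)

lemma G_var_a: "G var_a = var_b * var_a"
proof -
  have "frag_of (Word []) = (1 :: abpoly)"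
    using single_one[where 'a = abword and 'b = int] by (simp add: zero_abword_def)
  then show ?thesis by (simp add: var_a_def)
qed

lemma G_var_b: "G var_b = var_a * var_b"
proof -
  have "frag_of (Word []) = (1 :: abpoly)"
    using single_one[where 'a = abword and 'b = int] by (simp add: zero_abword_def)
  then show ?thesis by (simp add: var_b_def)
qed

lemma G_unique:
  assumes D: "is_derivation D" and a: "D var_a = var_b * var_a" and b: "D var_b = var_a * var_b"
  shows "D = G"
proof
  fix p
  have add: "D (p + q) = D p + D q" and mult: "D (p * q) = D p * q + p * D q" for p q
    using D by (simp_all add: is_derivation_def)
  have zero: "D 0 = 0" using add[of 0 0] by simp
  have diff: "D (p - q) = D p - D q" for p q using add[of "p - q" q] by simp
  have one: "D 1 = 0" using mult[of 1 1] by simp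
  have empty: "frag_of (Word []) = (1 :: abpoly)"
    using single_one[where 'a = abword and 'b = int] by (simp add: zero_abword_def)
  have letter: "D (frag_of (Word [x])) = G_letter x" for x
    using a b by (cases x) (simp_all add: var_a_def var_b_def)
  have word: "D (frag_of (Word w)) = G_word w" for w
  proof (induction w)
    case Nil
    then show ?case by (simp add: empty one)
  next
    case (Cons x w)
    have "frag_of (Word (x # w)) = (frag_of (Word [x]) * frag_of (Word w) :: abpoly)"
      by (simp only: frag_of_mult) (simp add: plus_abword_def)
    then show ?case by (simp only: mult letter Cons.IH G_word.simps)
  qed
  show "D p = G p"
  proof (rule frag_induction[of p UNIV])
    show "D (frag_of w) = G (frag_of w)" for w
      using word[of "letters w"] by simp
  qed (simp_all add: zero diff G_diff)
qed

lemma G_var_c: "G var_c = var_d"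
  by (simp add: var_c_def var_d_def G_add G_var_a G_var_b)

lemma G_var_d: "G var_d = var_c * var_d"
  by (simp add: var_c_def var_d_def G_add G_mult G_var_a G_var_b algebra_simps)

section \<open>Quasi-graded posets and their ab-index\<close>

text \<open>
  Only the values of \<open>zeta\<close> on intervals, i.e. at pairs \<open>x \<le> y\<close>, are meaningful.
\<close>

record 'e qgraded =
  elems :: "'e set"
  le :: "'e \<Rightarrow> 'e \<Rightarrow> bool"
  rk :: "'e \<Rightarrow> nat"
  zeta :: "'e \<Rightarrow> 'e \<Rightarrow> int"

definition lt :: "'e qgraded \<Rightarrow> 'e \<Rightarrow> 'e \<Rightarrow> bool" where
  "lt P x y \<longleftrightarrow> le P x y \<and> x \<noteq> y"

definition quasi_graded_poset :: "'e qgraded \<Rightarrow> bool" where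
  "quasi_graded_poset P \<longleftrightarrow>
     finite (elems P) \<and>
     reflp_on (elems P) (le P) \<and> antisymp_on (elems P) (le P) \<and> transp_on (elems P) (le P) \<and>
     (\<forall>x\<in>elems P. \<forall>y\<in>elems P. lt P x y \<longrightarrow> rk P x < rk P y) \<and>
     (\<forall>x\<in>elems P. zeta P x x = 1)"

definition is_min :: "'e qgraded \<Rightarrow> 'e \<Rightarrow> bool" where
  "is_min P z \<longleftrightarrow> z \<in> elems P \<and> (\<forall>x\<in>elems P. le P z x)"

definition is_max :: "'e qgraded \<Rightarrow> 'e \<Rightarrow> bool" where
  "is_max P z \<longleftrightarrow> z \<in> elems P \<and> (\<forall>x\<in>elems P. le P x z)"

definition pmin :: "'e qgraded \<Rightarrow> 'e" where "pmin P = (THE z. is_min P z)"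
definition pmax :: "'e qgraded \<Rightarrow> 'e" where "pmax P = (THE z. is_max P z)"

text \<open>The chains from the minimal to the maximal element, as strictly increasing lists.\<close>

definition full_chains :: "'e qgraded \<Rightarrow> 'e list set" where
  "full_chains P = {xs. xs \<noteq> [] \<and> set xs \<subseteq> elems P \<and> sorted_wrt (lt P) xs \<and>
                   hd xs = pmin P \<and> last xs = pmax P}"

fun chain_weight :: "'e qgraded \<Rightarrow> 'e list \<Rightarrow> abpoly" where
  "chain_weight P [x, y] = of_int (zeta P x y) * (var_a - var_b) ^ (rk P y - rk P x - 1)"
| "chain_weight P (x # y # z # xs) =
     of_int (zeta P x y) * (var_a - var_b) ^ (rk P y - rk P x - 1) * var_b *
     chain_weight P (y # z # xs)"
| "chain_weight P _ = 0"

definition ab_index :: "'e qgraded \<Rightarrow> abpoly" where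
  "ab_index P = (\<Sum>xs\<in>full_chains P. chain_weight P xs)"

section \<open>Semisuspensions\<close>

definition simplicial_complex :: "'v set set \<Rightarrow> bool" where
  "simplicial_complex \<Delta> \<longleftrightarrow>
     finite \<Delta> \<and> {} \<in> \<Delta> \<and> (\<forall>F\<in>\<Delta>. finite F) \<and> (\<forall>F\<in>\<Delta>. \<forall>F'. F' \<subseteq> F \<longrightarrow> F' \<in> \<Delta>)"

text \<open>
  The exponent \<open>dim H - dim F - 1 = card (H - F) - 1\<close> is \<open>- 1\<close> for \<open>H = F\<close>; it is replaced by
  the natural number \<open>card (H - F) + 1\<close> of the same parity.
\<close>

definition link_reduced_euler :: "'v set set \<Rightarrow> 'v set \<Rightarrow> int" where
  "link_reduced_euler \<Delta> F = (\<Sum>H \<in> {H\<in>\<Delta>. F \<subseteq> H}. (- 1) ^ (card (H - F) + 1))"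

datatype 'v semi_elem = Face "'v set" | Star | Top

fun semi_le :: "nat \<Rightarrow> 'v semi_elem \<Rightarrow> 'v semi_elem \<Rightarrow> bool" where
  "semi_le n (Face F) (Face H) \<longleftrightarrow> F \<subseteq> H"
| "semi_le n (Face F) Star \<longleftrightarrow> card F < n"
| "semi_le n Star (Face F) \<longleftrightarrow> False"
| "semi_le n Star Star \<longleftrightarrow> True"
| "semi_le n Top (Face F) \<longleftrightarrow> False"
| "semi_le n Top Star \<longleftrightarrow> False"
| "semi_le n _ Top \<longleftrightarrow> True"

text \<open>The rank \<open>dim F + 1\<close> of a face is its number of vertices.\<close>

fun semi_rk :: "nat \<Rightarrow> 'v semi_elem \<Rightarrow> nat" where
  "semi_rk n (Face F) = card F"
| "semi_rk n Star = n"
| "semi_rk n Top = n + 1"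

fun semi_zeta :: "'v set set \<Rightarrow> nat \<Rightarrow> 'v semi_elem \<Rightarrow> 'v semi_elem \<Rightarrow> int" where
  "semi_zeta \<Delta> n (Face F) Star = 1 + (- 1) ^ (n - card F) * link_reduced_euler \<Delta> F"
| "semi_zeta \<Delta> n _ _ = 1"

definition semi :: "'v set set \<Rightarrow> nat \<Rightarrow> 'v semi_elem qgraded" where
  "semi \<Delta> n =
     \<lparr> elems = Face ` \<Delta> \<union> (if n = 0 then {} else {Star}) \<union> {Top},
       le = semi_le n,
       rk = semi_rk n,
       zeta = semi_zeta \<Delta> n \<rparr>"

text \<open>
  The \<open>k\<close>-dimensional simplex has vertex set \<open>{0..k}\<close>; by symmetry it does not matter which
  \<open>i + 1\<close> of its facets are chosen.
\<close>

definition shelling_complex :: "nat \<Rightarrow> nat \<Rightarrow> nat set set" where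
  "shelling_complex k i = {F. \<exists>j\<le>i. F \<subseteq> {0..k} - {j}}"

definition Psi_semi :: "nat \<Rightarrow> nat \<Rightarrow> nat \<Rightarrow> abpoly" where
  "Psi_semi n k i = ab_index (semi (shelling_complex k i) n)"

definition Phi_check :: "nat \<Rightarrow> nat \<Rightarrow> nat \<Rightarrow> abpoly" where
  "Phi_check n k i =
     (if i = 0 then Psi_semi n k 0 else Psi_semi n k i - Psi_semi n k (i - 1))"

section \<open>The other two families of posets\<close>

definition boolean_algebra_poset :: "nat \<Rightarrow> nat set qgraded" where
  "boolean_algebra_poset k =
     \<lparr> elems = Pow {..<k}, le = (\<subseteq>), rk = card, zeta = (\<lambda>_ _. 1) \<rparr>"

datatype omega_elem = OBot | OP | OC | OTop

definition omega :: "nat \<Rightarrow> omega_elem qgraded" where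
  "omega m =
     \<lparr> elems = {OBot, OP, OC, OTop},
       le = (\<lambda>x y. x = y \<or> x = OBot \<or> y = OTop \<or> (x = OP \<and> y = OC \<and> m \<ge> 2)),
       rk = (\<lambda>x. case x of OBot \<Rightarrow> 0 | OP \<Rightarrow> 1 | OC \<Rightarrow> m | OTop \<Rightarrow> m + 1),
       zeta = (\<lambda>x y. if x = OP \<and> y = OC then 1 + (- 1) ^ m else 1) \<rparr>"

section \<open>All of these are quasi-graded posets with a minimal and a maximal element\<close>

lemma pmin_eq: "quasi_graded_poset P \<Longrightarrow> is_min P z \<Longrightarrow> pmin P = z"
  unfolding pmin_def quasi_graded_poset_def is_min_def antisymp_on_def by (rule the_equality) blast+

lemma pmax_eq: "quasi_graded_poset P \<Longrightarrow> is_max P z \<Longrightarrow> pmax P = z"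
  unfolding pmax_def quasi_graded_poset_def is_max_def antisymp_on_def by (rule the_equality) blast+

lemma simplicial_complex_shelling_complex: "simplicial_complex (shelling_complex k i)"
proof -
  have "shelling_complex k i \<subseteq> Pow {0..k}" by (auto simp: shelling_complex_def)
  then have "finite (shelling_complex k i)" by (rule finite_subset) simp
  moreover have "\<forall>F\<in>shelling_complex k i. finite F"
    by (auto simp: shelling_complex_def intro: finite_subset[OF _ finite_Diff[OF finite_atLeastAtMost]])
  ultimately show ?thesis
    unfolding simplicial_complex_def by (fastforce simp: shelling_complex_def)
qed

lemma card_shelling_complex:
  assumes "i \<le> k" "F \<in> shelling_complex k i" shows "card F \<le> k"
proof -
  obtain j where "j \<le> i" and F: "F \<subseteq> {0..k} - {j}" using assms(2) by (auto simp: shelling_complex_def)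
  then have "card ({0..k} - {j}) = k" using assms(1) by (simp add: card_Diff_singleton)
  then show ?thesis using card_mono[OF _ F] by simp
qed

lemma semi_quasi_graded:
  assumes \<Delta>: "simplicial_complex \<Delta>" and dim: "\<forall>F\<in>\<Delta>. card F \<le> n"
  shows "quasi_graded_poset (semi \<Delta> n)"
    and "is_min (semi \<Delta> n) (Face {})" and "is_max (semi \<Delta> n) Top"
proof -
  have fin: "finite F" if "F \<in> \<Delta>" for F using that \<Delta> by (simp add: simplicial_complex_def)
  have less: "card F < n" if "F \<subseteq> H" "H \<in> \<Delta>" "card H < n" for F H
    using card_mono[OF fin that(1)] that by simp
  have "transp_on (elems (semi \<Delta> n)) (semi_le n)"
    by (rule transp_onI) (auto simp: semi_def split: if_splits dest: less)
  moreover have "antisymp_on (elems (semi \<Delta> n)) (semi_le n)"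
    by (rule antisymp_onI) (auto simp: semi_def split: if_splits)
  moreover have "reflp_on (elems (semi \<Delta> n)) (semi_le n)"
    by (rule reflp_onI) (auto simp: semi_def split: if_splits)
  moreover have "\<forall>x\<in>elems (semi \<Delta> n). \<forall>y\<in>elems (semi \<Delta> n).
      lt (semi \<Delta> n) x y \<longrightarrow> semi_rk n x < semi_rk n y"
    using dim by (auto simp: semi_def lt_def less_Suc_eq_le split: if_splits intro!: psubset_card_mono fin)
  ultimately show "quasi_graded_poset (semi \<Delta> n)"
    using \<Delta> by (auto simp: quasi_graded_poset_def semi_def simplicial_complex_def)
  show "is_min (semi \<Delta> n) (Face {})" "is_max (semi \<Delta> n) Top"
    using \<Delta> by (auto simp: is_min_def is_max_def semi_def simplicial_complex_def)
qed

lemma boolean_algebra_quasi_graded: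
  "quasi_graded_poset (boolean_algebra_poset k)"
  "is_min (boolean_algebra_poset k) {}" "is_max (boolean_algebra_poset k) {..<k}"
  by (auto simp: quasi_graded_poset_def boolean_algebra_poset_def is_min_def is_max_def lt_def
      reflp_on_def antisymp_on_def transp_on_def
      intro!: psubset_card_mono intro: finite_subset)

lemma omega_quasi_graded:
  assumes "m \<ge> 1"
  shows "quasi_graded_poset (omega m)" "is_min (omega m) OBot" "is_max (omega m) OTop"
  using assms
  by (auto simp: quasi_graded_poset_def omega_def is_min_def is_max_def lt_def
      reflp_on_def antisymp_on_def transp_on_def)

end

theory Submission
  imports Defs
begin

text \<open>
  Put \<open>e = a - b\<close>, \<open>W\<^sub>0 = 1\<close> and \<open>W\<^sub>r = \<Psi>(B\<^sub>r) b\<close>. Since the interval below a face is Boolean,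
  splitting chains at their penultimate element writes the index of a semisuspension as a sum of
  \<open>W\<^bsub>|F|\<^esub> U\<^bsub>n-|F|\<^esub>\<close> over all faces and of \<open>W\<^bsub>|F|\<^esub> E\<^bsub>n-|F|\<^esub>\<close>, weighted by the Euler characteristic of the
  link, where \<open>U\<^sub>m = e\<^bsup>m-1\<^esup> a\<close> and \<open>E\<^sub>m = e\<^bsup>m-1\<^esup> b\<close>. In the shelling complex this
  characteristic vanishes unless \<open>F\<close> contains the vertices \<open>i+1, \<dots>, k\<close>, and then the sign of the weight does not depend
  on \<open>F\<close>. Hence the shelling components are explicit binomial sums. As \<open>G\<close> acts on powers of \<open>e\<close> as
  the commutator with \<open>b\<close>, one gets \<open>G(W\<^sub>r) = W\<^bsub>r+1\<^esub> - W\<^sub>r b\<close>, \<open>G(W\<^sub>s U\<^sub>m) = W\<^bsub>s+1\<^esub> U\<^sub>m\<close> and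
  \<open>G(W\<^sub>s E\<^sub>m) = W\<^bsub>s+1\<^esub> E\<^sub>m + W\<^sub>s E\<^bsub>m+1\<^esub>\<close> for \<open>m \<ge> 1\<close>, so that \<open>G\<close> turns the binomial sums for \<open>(n,k,i)\<close>
  into those for \<open>(n+1,k+1,i+1)\<close> by Pascal's rule.
\<close>

section \<open>Splitting chains at their penultimate element\<close>

text \<open>Generalises \<open>full_chains\<close> to any upper end, so that cutting off the last
  element stays within the family.\<close>

definition chains_to :: "'e qgraded \<Rightarrow> 'e \<Rightarrow> 'e list set" where
  "chains_to P y = {xs. xs \<noteq> [] \<and> set xs \<subseteq> elems P \<and> sorted_wrt (lt P) xs \<and>
                   hd xs = pmin P \<and> last xs = y}"

definition index_to :: "'e qgraded \<Rightarrow> 'e \<Rightarrow> abpoly" where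
  "index_to P y = (\<Sum>xs\<in>chains_to P y. chain_weight P xs)"

text \<open>What a chain collects up to its penultimate element. The minimum needs its own value 1:
  no \<open>b\<close> precedes the first interval, while \<open>index_to\<close> is 0 there.\<close>

definition prefix_index :: "'e qgraded \<Rightarrow> 'e \<Rightarrow> abpoly" where
  "prefix_index P x = (if x = pmin P then 1 else index_to P x * var_b)"

abbreviation var_e :: abpoly where "var_e \<equiv> var_a - var_b"

lemma ab_index_eq_index_to: "ab_index P = index_to P (pmax P)"
  by (simp add: ab_index_def index_to_def full_chains_def chains_to_def)

lemma chain_weight_snoc:
  "xs \<noteq> [] \<Longrightarrow> chain_weight P (xs @ [y, z]) =
    chain_weight P (xs @ [y]) * var_b * (of_int (zeta P y z) * var_e ^ (rk P z - rk P y - 1))"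
proof (induction xs rule: list_nonempty_induct)
  case (single x)
  then show ?case by (simp add: mult.assoc)
next
  case (cons x xs)
  then obtain u us where "xs = u # us" by (cases xs) auto
  then show ?case using cons.IH by (cases us) (simp_all add: mult.assoc)
qed

lemma sorted_wrt_lt_distinct: "sorted_wrt (lt P) xs \<Longrightarrow> distinct xs"
  by (induction xs) (auto simp: lt_def)

lemma finite_chains_to:
  assumes "quasi_graded_poset P" shows "finite (chains_to P y)"
proof (rule finite_subset)
  show "chains_to P y \<subseteq> {xs. set xs \<subseteq> elems P \<and> distinct xs}"
    by (auto simp: chains_to_def sorted_wrt_lt_distinct)
  show "finite {xs. set xs \<subseteq> elems P \<and> distinct xs}"
    using assms by (intro finite_subset_distinct) (simp add: quasi_graded_poset_def)
qed

lemma lt_trans_on: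
  assumes "quasi_graded_poset P" "x \<in> elems P" "y \<in> elems P" "z \<in> elems P" "lt P x y" "lt P y z"
  shows "lt P x z"
  using assms unfolding quasi_graded_poset_def lt_def transp_on_def antisymp_on_def by metis

lemma sorted_wrt_last:
  "sorted_wrt R xs \<Longrightarrow> x \<in> set xs \<Longrightarrow> x = last xs \<or> R x (last xs)"
  by (induction xs) (auto split: if_splits)

text \<open>A longer chain would make the minimum strictly smaller than itself.\<close>

lemma chains_to_pmin:
  assumes "pmin P \<in> elems P" shows "chains_to P (pmin P) = {[pmin P]}"
proof -
  have "xs = [pmin P]" if "xs \<in> chains_to P (pmin P)" for xs
  proof (cases xs)
    case (Cons u us)
    with that show ?thesis
      by (cases us rule: rev_cases) (auto simp: chains_to_def lt_def)
  qed (use that in \<open>auto simp: chains_to_def\<close>)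
  moreover have "[pmin P] \<in> chains_to P (pmin P)" using assms by (simp add: chains_to_def)
  ultimately show ?thesis by blast
qed

lemma chains_to_eq_UN:
  assumes P: "quasi_graded_poset P" and y: "y \<in> elems P" "y \<noteq> pmin P"
  shows "chains_to P y = (\<Union>x\<in>{x\<in>elems P. lt P x y}. (\<lambda>xs. xs @ [y]) ` chains_to P x)"
    (is "_ = ?R")
proof
  show "chains_to P y \<subseteq> ?R"
  proof
    fix xs assume xs: "xs \<in> chains_to P y"
    then obtain us where us: "xs = us @ [y]"
      by (cases xs rule: rev_cases) (auto simp: chains_to_def)
    with xs y have ne: "us \<noteq> []" by (auto simp: chains_to_def)
    with xs us have "us \<in> chains_to P (last us)" "last us \<in> elems P" "lt P (last us) y"
      by (auto simp: chains_to_def sorted_wrt_append)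
    with us show "xs \<in> ?R" by blast
  qed
  show "?R \<subseteq> chains_to P y"
  proof
    fix xs assume "xs \<in> ?R"
    then obtain x us where x: "x \<in> elems P" "lt P x y" and us: "us \<in> chains_to P x" "xs = us @ [y]"
      by blast
    \<comment> \<open>Each element of \<open>us\<close> is \<open>x\<close> or lies below
      \<open>x\<close>, hence below \<open>y\<close> by transitivity.\<close>
    have "lt P u y" if "u \<in> set us" for u
      using sorted_wrt_last[of "lt P" us u] that us x lt_trans_on[OF P _ x(1) y(1) _ x(2)]
      by (auto simp: chains_to_def)
    with us y show "xs \<in> chains_to P y" by (auto simp: chains_to_def sorted_wrt_append)
  qed
qed

text \<open>Chains ending in \<open>y\<close> are grouped by their penultimate element
  \<open>x\<close>; within a group all weights share the same last factor on the right.\<close>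

lemma index_to_rec:
  assumes P: "quasi_graded_poset P" and z: "is_min P (pmin P)"
    and y: "y \<in> elems P" "y \<noteq> pmin P"
  shows "index_to P y = (\<Sum>x\<in>{x\<in>elems P. lt P x y}.
    prefix_index P x * (of_int (zeta P x y) * var_e ^ (rk P y - rk P x - 1)))"
proof -
  have disj: "(\<lambda>xs. xs @ [y]) ` chains_to P u \<inter> (\<lambda>xs. xs @ [y]) ` chains_to P v = {}"
    if "u \<noteq> v" for u v
    using that by (auto simp: chains_to_def)
  have "index_to P y =
      (\<Sum>x\<in>{x\<in>elems P. lt P x y}. \<Sum>xs\<in>(\<lambda>xs. xs @ [y]) ` chains_to P x. chain_weight P xs)"
    unfolding index_to_def chains_to_eq_UN[OF P y]
    by (rule sum.UNION_disjoint)
      (use P disj in \<open>auto simp: finite_chains_to quasi_graded_poset_def\<close>)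
  also have "\<dots> = (\<Sum>x\<in>{x\<in>elems P. lt P x y}. \<Sum>xs\<in>chains_to P x. chain_weight P (xs @ [y]))"
    by (intro sum.cong[OF refl] sum.reindex_cong[where l = "\<lambda>xs. xs @ [y]"]) (auto simp: inj_on_def)
  also have "\<dots> = (\<Sum>x\<in>{x\<in>elems P. lt P x y}.
    prefix_index P x * (of_int (zeta P x y) * var_e ^ (rk P y - rk P x - 1)))"
  proof (rule sum.cong[OF refl])
    fix x assume x: "x \<in> {x\<in>elems P. lt P x y}"
    show "(\<Sum>xs\<in>chains_to P x. chain_weight P (xs @ [y])) =
      prefix_index P x * (of_int (zeta P x y) * var_e ^ (rk P y - rk P x - 1))"
    proof (cases "x = pmin P")
      case True
      then show ?thesis using z by (simp add: chains_to_pmin is_min_def prefix_index_def)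
    next
      case False
      have "chain_weight P (xs @ [y]) =
        chain_weight P xs * var_b * (of_int (zeta P x y) * var_e ^ (rk P y - rk P x - 1))"
        if "xs \<in> chains_to P x" for xs
      proof -
        have "xs = butlast xs @ [x]" using that by (auto simp: chains_to_def)
        then obtain us where us: "xs = us @ [x]" by blast
        with that False have "us \<noteq> []" by (auto simp: chains_to_def)
        then show ?thesis using chain_weight_snoc us by fastforce
      qed
      then show ?thesis using False
        by (simp add: prefix_index_def index_to_def sum_distrib_right)
    qed
  qed
  finally show ?thesis .
qed

section \<open>Boolean intervals\<close>

text \<open>This is \<open>index_to_rec\<close> for the Boolean algebra of rank \<open>r\<close>,
  with the elements below the top collected by rank \<open>s\<close>.\<close>

function boolean_index :: "nat \<Rightarrow> abpoly" where
  "boolean_index r = (\<Sum>s<r. of_nat (r choose s) *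
     ((if s = 0 then 1 else boolean_index s * var_b) * var_e ^ (r - s - 1)))"
  by auto
termination by (relation "measure id") auto

declare boolean_index.simps [simp del]

text \<open>The \<open>W\<close> of the overview. The case 0 is separate because
  \<open>boolean_index 0\<close> is an empty sum.\<close>

definition boolean_prefix :: "nat \<Rightarrow> abpoly" where
  "boolean_prefix s = (if s = 0 then 1 else boolean_index s * var_b)"

lemma boolean_index_rec:
  "boolean_index r =
    (\<Sum>s<r. of_nat (r choose s) * (boolean_prefix s * var_e ^ (r - s - 1)))"
  by (subst boolean_index.simps) (simp add: boolean_prefix_def)

lemma boolean_prefix_rec:
  assumes "r > 0"
  shows "boolean_prefix r =
    (\<Sum>s<r. of_nat (r choose s) * (boolean_prefix s * (var_e ^ (r - s - 1) * var_b)))"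
  using assms boolean_index_rec[of r]
  by (simp add: boolean_prefix_def[of r] sum_distrib_right mult.assoc)

text \<open>Removing \<open>A\<close> identifies the interval with the subsets of
  \<open>B - A\<close>, which are then counted by size.\<close>

lemma sum_card_interval:
  fixes f :: "nat \<Rightarrow> abpoly"
  assumes "finite B" "A \<subseteq> B"
  shows "(\<Sum>F | A \<subseteq> F \<and> F \<subseteq> B. f (card F)) =
    (\<Sum>s\<le>card B - card A. of_nat ((card B - card A) choose s) * f (card A + s))"
proof -
  let ?C = "B - A"
  have finA: "finite A" and finC: "finite ?C" and cardC: "card ?C = card B - card A"
    using assms finite_subset[OF assms(2)] by (simp_all add: card_Diff_subset)
  have "(\<Sum>F | A \<subseteq> F \<and> F \<subseteq> B. f (card F)) = (\<Sum>X\<in>Pow ?C. f (card (A \<union> X)))"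
    by (rule sum.reindex_bij_witness[of _ "\<lambda>X. A \<union> X" "\<lambda>F. F - A"])
      (use assms in \<open>auto simp: Un_absorb1\<close>)
  also have "\<dots> = (\<Sum>X\<in>Pow ?C. f (card A + card X))"
    using finA finC by (intro sum.cong refl arg_cong[where f = f] card_Un_disjoint)
      (auto intro: finite_subset)
  also have "\<dots> = (\<Sum>s\<le>card ?C. \<Sum>X | X \<in> Pow ?C \<and> card X = s. f (card A + card X))"
    using finC by (intro sum.group[symmetric]) (auto intro: card_mono)
  also have "\<dots> = (\<Sum>s\<le>card ?C. of_nat (card ?C choose s) * f (card A + s))"
    using finC by (intro sum.cong refl) (simp add: n_subsets)
  finally show ?thesis by (simp add: cardC)
qed

lemma sum_card_strict_subsets:
  fixes f :: "nat \<Rightarrow> abpoly"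
  assumes "finite B"
  shows "(\<Sum>F | F \<subset> B. f (card F)) = (\<Sum>s<card B. of_nat (card B choose s) * f s)"
proof -
  have eq: "{F. F \<subseteq> B} = insert B {F. F \<subset> B}" by auto
  have "f (card B) + (\<Sum>F | F \<subset> B. f (card F)) = (\<Sum>F | F \<subseteq> B. f (card F))"
    unfolding eq using assms by (subst sum.insert) (auto intro: finite_subset[of _ "Pow B"])
  also have "\<dots> = (\<Sum>s\<le>card B. of_nat (card B choose s) * f s)"
    using sum_card_interval[of B "{}" f] assms by simp
  finally show ?thesis by (simp add: lessThan_Suc_atMost[symmetric])
qed

text \<open>Strong induction on the size of the face: by \<open>index_to_rec\<close> only its proper
  subsets enter, which gives the recursion of \<open>boolean_index\<close>. The embedding
  \<open>\<phi>\<close> lets this serve both Boolean algebras (\<open>id\<close>) and the faces of a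
  semisuspension (\<open>Face\<close>).\<close>

lemma index_to_boolean:
  assumes P: "quasi_graded_poset P" and min: "is_min P (\<phi> {})"
    and \<Delta>: "\<And>F H. F \<in> \<Delta> \<Longrightarrow> H \<subseteq> F \<Longrightarrow> H \<in> \<Delta>" "\<And>F. F \<in> \<Delta> \<Longrightarrow> finite F"
    and inj: "inj \<phi>"
    and elem: "\<And>F. F \<in> \<Delta> \<Longrightarrow> \<phi> F \<in> elems P"
    and below: "\<And>F. F \<in> \<Delta> \<Longrightarrow> {x\<in>elems P. lt P x (\<phi> F)} = \<phi> ` {H. H \<subset> F}"
    and rk: "\<And>F. F \<in> \<Delta> \<Longrightarrow> rk P (\<phi> F) = card F"
    and zeta: "\<And>F H. F \<in> \<Delta> \<Longrightarrow> H \<subset> F \<Longrightarrow> zeta P (\<phi> H) (\<phi> F) = 1"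
  shows "F \<in> \<Delta> \<Longrightarrow> F \<noteq> {} \<Longrightarrow> index_to P (\<phi> F) = boolean_index (card F)"
    and "F \<in> \<Delta> \<Longrightarrow> prefix_index P (\<phi> F) = boolean_prefix (card F)"
proof -
  have pm: "pmin P = \<phi> {}" using P min by (rule pmin_eq)
  have main: "index_to P (\<phi> F) = boolean_index (card F)" if "F \<in> \<Delta>" "F \<noteq> {}" for F
    using that
  proof (induction "card F" arbitrary: F rule: less_induct)
    case less
    have fin: "finite F" using less.prems \<Delta> by blast
    have ne: "\<phi> F \<noteq> pmin P" using less.prems inj pm by (auto dest: injD)
    have pre: "prefix_index P (\<phi> H) = boolean_prefix (card H)" if "H \<subset> F" for H
      using less.hyps[of H] less.prems \<Delta>(1)[of F H] that psubset_card_mono[OF fin that]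
        finite_subset[OF _ fin] inj
      by (cases "H = {}") (auto simp: prefix_index_def boolean_prefix_def pm dest: injD)
    have "index_to P (\<phi> F) = (\<Sum>H | H \<subset> F.
        prefix_index P (\<phi> H) * (of_int (zeta P (\<phi> H) (\<phi> F)) *
          var_e ^ (rk P (\<phi> F) - rk P (\<phi> H) - 1)))"
      using less.prems min pm ne
      by (subst index_to_rec[OF P]) (auto simp: elem below sum.reindex inj_on_subset[OF inj])
    also have "\<dots> = (\<Sum>H | H \<subset> F. boolean_prefix (card H) * var_e ^ (card F - card H - 1))"
      using less.prems \<Delta>(1)[OF less.prems(1)] by (intro sum.cong refl) (auto simp: zeta pre rk)
    also have "\<dots> = boolean_index (card F)"
      by (simp only: boolean_index_rec sum_card_strict_subsets[OF fin,
          where f = "\<lambda>s. boolean_prefix s * var_e ^ (card F - s - 1)"])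
    finally show ?case .
  qed
  show "F \<in> \<Delta> \<Longrightarrow> F \<noteq> {} \<Longrightarrow> index_to P (\<phi> F) = boolean_index (card F)" by (rule main)
  show "prefix_index P (\<phi> F) = boolean_prefix (card F)" if "F \<in> \<Delta>"
    using main[OF that] that \<Delta>(2)[OF that] inj
    by (cases "F = {}") (auto simp: prefix_index_def boolean_prefix_def pm dest: injD)
qed

lemma ab_index_boolean_algebra:
  assumes "k \<ge> 1"
  shows "ab_index (boolean_algebra_poset k) = boolean_index k"
proof -
  let ?P = "boolean_algebra_poset k"
  note P = boolean_algebra_quasi_graded[of k]
  have "index_to ?P (id {..<k}) = boolean_index (card {..<k})"
    by (rule index_to_boolean(1)[where \<Delta> = "Pow {..<k}"])
      (use P assms in \<open>auto simp: boolean_algebra_poset_def lt_def lessThan_empty_iff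
        intro: finite_subset\<close>)
  then show ?thesis using P by (simp add: ab_index_eq_index_to pmax_eq)
qed

section \<open>Semisuspensions\<close>

text \<open>The penultimate element of a chain to \<open>Top\<close> is a face, giving the first
  sum, or \<open>Star\<close>; chains through \<open>Star\<close> are split once more at the face
  before it, giving the second sum.\<close>

lemma ab_index_semi:
  assumes \<Delta>: "simplicial_complex \<Delta>" and dim: "\<forall>F\<in>\<Delta>. card F \<le> n"
  shows "ab_index (semi \<Delta> n) =
    (\<Sum>F\<in>\<Delta>. boolean_prefix (card F) * var_e ^ (n - card F)) +
    (\<Sum>F | F \<in> \<Delta> \<and> card F < n. boolean_prefix (card F) *
      (of_int (1 + (- 1) ^ (n - card F) * link_reduced_euler \<Delta> F) *
        (var_e ^ (n - card F - 1) * var_b)))"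
proof -
  define P where "P = semi \<Delta> n"
  have qg: "quasi_graded_poset P" and min: "is_min P (Face {})" and max: "is_max P Top"
    unfolding P_def by (rule semi_quasi_graded[OF \<Delta> dim])+
  have pm: "pmin P = Face {}" "pmax P = Top" using qg min max by (simp_all add: pmin_eq pmax_eq)
  note rec = index_to_rec[OF qg, unfolded pm, OF min]
  have fin: "finite \<Delta>" and sub: "\<And>F H. F \<in> \<Delta> \<Longrightarrow> H \<subseteq> F \<Longrightarrow> H \<in> \<Delta>"
    and finF: "\<And>F. F \<in> \<Delta> \<Longrightarrow> finite F" using \<Delta> by (auto simp: simplicial_complex_def)
  let ?S = "if n = 0 then {} else {Star :: 'a semi_elem}"
  have elems_eq: "elems P = Face ` \<Delta> \<union> ?S \<union> {Top}" by (simp add: P_def semi_def)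
  then have elems: "F \<in> \<Delta> \<Longrightarrow> Face F \<in> elems P" "Top \<in> elems P" "n > 0 \<Longrightarrow> Star \<in> elems P" for F
    by simp_all
  have rks: "rk P (Face F) = card F" "rk P Star = n" "rk P Top = n + 1"
    and zetas: "zeta P (Face F) (Face H) = 1" "zeta P x Top = 1"
      "zeta P (Face F) Star = 1 + (- 1) ^ (n - card F) * link_reduced_euler \<Delta> F"
    and lts: "lt P (Face H) (Face F) \<longleftrightarrow> H \<subset> F" "\<not> lt P Star (Face F)" "\<not> lt P Top (Face F)"
      "lt P (Face F) Star \<longleftrightarrow> card F < n" "\<not> lt P Star Star" "\<not> lt P Top Star"
      "lt P (Face F) Top" "lt P Star Top" "\<not> lt P Top Top" for F H x
    by (cases x; auto simp: P_def semi_def lt_def)+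
  have below_face: "{x\<in>elems P. lt P x (Face F)} = Face ` {H. H \<subset> F}" if "F \<in> \<Delta>" for F
  proof (rule set_eqI)
    show "x \<in> {x\<in>elems P. lt P x (Face F)} \<longleftrightarrow> x \<in> Face ` {H. H \<subset> F}" for x
      using sub[OF that, of "case x of Face H \<Rightarrow> H"]
      by (cases x) (simp_all add: elems_eq lts image_iff, blast)
  qed
  have below_star: "{x\<in>elems P. lt P x Star} = Face ` {F\<in>\<Delta>. card F < n}"
  proof (rule set_eqI)
    show "x \<in> {x\<in>elems P. lt P x Star} \<longleftrightarrow> x \<in> Face ` {F\<in>\<Delta>. card F < n}" for x
      by (cases x) (simp_all add: elems_eq lts image_iff)
  qed
  have below_top: "{x\<in>elems P. lt P x Top} = Face ` \<Delta> \<union> ?S"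
  proof (rule set_eqI)
    show "x \<in> {x\<in>elems P. lt P x Top} \<longleftrightarrow> x \<in> Face ` \<Delta> \<union> ?S" for x
      by (cases x) (simp_all add: elems_eq lts image_iff)
  qed
  have pre: "prefix_index P (Face F) = boolean_prefix (card F)" if "F \<in> \<Delta>" for F
    by (rule index_to_boolean(2)[where \<Delta> = \<Delta>, OF qg min sub finF _ elems(1) below_face])
      (use that in \<open>simp_all add: inj_def rks zetas\<close>)
  have star: "index_to P Star = (\<Sum>F | F \<in> \<Delta> \<and> card F < n. boolean_prefix (card F) *
      (of_int (1 + (- 1) ^ (n - card F) * link_reduced_euler \<Delta> F) * var_e ^ (n - card F - 1)))"
    if "n > 0"
    using rec[OF elems(3)[OF that]] by (simp add: below_star sum.reindex inj_on_def rks zetas pre)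
  have "ab_index P = (\<Sum>x\<in>Face ` \<Delta> \<union> ?S. prefix_index P x * var_e ^ (n - rk P x))"
    unfolding ab_index_eq_index_to pm using rec[OF elems(2)] by (simp add: below_top rks zetas)
  also have "\<dots> = (\<Sum>x\<in>Face ` \<Delta>. prefix_index P x * var_e ^ (n - rk P x)) +
      (\<Sum>x\<in>?S. prefix_index P x * var_e ^ (n - rk P x))"
    by (rule sum.union_disjoint) (use fin in auto)
  also have "(\<Sum>x\<in>Face ` \<Delta>. prefix_index P x * var_e ^ (n - rk P x)) =
      (\<Sum>F\<in>\<Delta>. boolean_prefix (card F) * var_e ^ (n - card F))"
    by (simp add: sum.reindex inj_on_def rks pre)
  also have "(\<Sum>x\<in>?S. prefix_index P x * var_e ^ (n - rk P x)) =
      (\<Sum>F | F \<in> \<Delta> \<and> card F < n. boolean_prefix (card F) *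
      (of_int (1 + (- 1) ^ (n - card F) * link_reduced_euler \<Delta> F) *
        (var_e ^ (n - card F - 1) * var_b)))"
    \<comment> \<open>For \<open>n = 0\<close> there is no \<open>Star\<close>, and the sum over
      faces with \<open>card F < n\<close> is empty as well.\<close>
    by (cases "n = 0") (simp_all add: prefix_index_def pm star rks sum_distrib_right mult.assoc)
  finally show ?thesis by (simp only: P_def)
qed

text \<open>At \<open>m = 0\<close> the face has rank \<open>n\<close> and reaches
  \<open>Top\<close> only directly, with factor \<open>var_e ^ 0\<close>.\<close>

definition cap_a :: "nat \<Rightarrow> abpoly" where
  "cap_a m = (if m = 0 then 1 else var_e ^ (m - 1) * var_a)"

text \<open>The value 0 at \<open>m = 0\<close> reflects that faces of rank \<open>n\<close> are not
  below \<open>Star\<close>.\<close>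

definition cap_b :: "nat \<Rightarrow> abpoly" where
  "cap_b m = (if m = 0 then 0 else var_e ^ (m - 1) * var_b)"

text \<open>The summand 1 of \<open>zeta\<close> from \<open>F\<close> to \<open>Star\<close> merges
  with the direct step to \<open>Top\<close>, since \<open>e^m + e^(m-1) b = e^(m-1) a\<close> for
  \<open>m \<ge> 1\<close>; the Euler characteristic stays with \<open>cap_b\<close>.\<close>

lemma ab_index_semi_caps:
  assumes \<Delta>: "simplicial_complex \<Delta>" and dim: "\<forall>F\<in>\<Delta>. card F \<le> n"
  shows "ab_index (semi \<Delta> n) = (\<Sum>F\<in>\<Delta>. boolean_prefix (card F) * cap_a (n - card F)) +
    (\<Sum>F\<in>\<Delta>. of_int ((- 1) ^ (n - card F) * link_reduced_euler \<Delta> F) *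
      (boolean_prefix (card F) * cap_b (n - card F)))"
proof -
  have fin: "finite \<Delta>" using \<Delta> by (simp add: simplicial_complex_def)
  have cap: "cap_a m = var_e ^ m + cap_b m" for m
    by (cases m) (simp_all add: cap_a_def cap_b_def power_Suc2 right_diff_distrib del: power_Suc)
  have comm: "p * (of_int j * q) = of_int j * (p * q)" for p q :: abpoly and j
    by (metis mult.assoc mult_of_int_commute)
  have "(\<Sum>F | F \<in> \<Delta> \<and> card F < n. boolean_prefix (card F) *
      (of_int (1 + (- 1) ^ (n - card F) * link_reduced_euler \<Delta> F) *
        (var_e ^ (n - card F - 1) * var_b))) =
    (\<Sum>F | F \<in> \<Delta> \<and> card F < n. of_int (1 + (- 1) ^ (n - card F) * link_reduced_euler \<Delta> F) *
        (boolean_prefix (card F) * cap_b (n - card F)))"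
    by (intro sum.cong refl) (simp only: comm cap_b_def, simp)
  also have "\<dots> = (\<Sum>F\<in>\<Delta>. of_int (1 + (- 1) ^ (n - card F) * link_reduced_euler \<Delta> F) *
        (boolean_prefix (card F) * cap_b (n - card F)))"
    \<comment> \<open>The added faces have \<open>card F \<ge> n\<close>, where \<open>cap_b\<close>
      vanishes.\<close>
    by (rule sum.mono_neutral_left) (use fin in \<open>auto simp: cap_b_def\<close>)
  finally show ?thesis
    by (simp add: ab_index_semi[OF assms] cap sum.distrib algebra_simps)
qed


section \<open>The shelling complexes\<close>

text \<open>The sum expands the product of factors 1 - 1 over \<open>V - F\<close>, which is 0
  unless this set is empty.\<close>

lemma sum_alternating_interval:
  assumes "finite V" "F \<subseteq> V"
  shows "(\<Sum>H | F \<subseteq> H \<and> H \<subseteq> V. (- 1) ^ card (H - F)) = (if F = V then 1 else 0 :: int)"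
proof -
  have fin: "finite (V - F)" using assms by simp
  have "(\<Sum>H | F \<subseteq> H \<and> H \<subseteq> V. (- 1) ^ card (H - F)) = (\<Sum>X\<in>Pow (V - F). (- 1) ^ card X :: int)"
    by (rule sum.reindex_bij_witness[of _ "\<lambda>X. F \<union> X" "\<lambda>H. H - F"])
      (use assms in \<open>auto simp: Un_Diff Diff_triv intro!: arg_cong[where f = card]\<close>)
  also have "\<dots> = (\<Prod>x\<in>V - F. 1 - 1)"
    using prod_diff_conv_sum[OF fin, of "\<lambda>_. 1 :: int" "\<lambda>_. 1"] by simp
  also have "\<dots> = (if F = V then 1 else 0)" using assms fin by auto
  finally show ?thesis .
qed

text \<open>Lying in the facet opposite \<open>j\<close> means omitting \<open>j\<close>, so the
  sets missing from the complex form the interval above \<open>{0..i}\<close>.\<close>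

lemma mem_shelling_complex:
  assumes "i \<le> k"
  shows "F \<in> shelling_complex k i \<longleftrightarrow> F \<subseteq> {0..k} \<and> \<not> {0..i} \<subseteq> F"
  using assms by (auto simp: shelling_complex_def)

text \<open>Over all supersets of \<open>F\<close> in the simplex the alternating sum is 0, as
  \<open>F\<close> is proper. Up to sign, the link sum is therefore the sum over the supersets
  outside the complex. These form the interval from \<open>F \<union> {0..i}\<close> to
  \<open>{0..k}\<close>, whose sum vanishes unless it is a single point.\<close>

lemma link_reduced_euler_shelling_complex:
  assumes ik: "i \<le> k" and F: "F \<in> shelling_complex k i"
  shows "link_reduced_euler (shelling_complex k i) F =
    (if {i+1..k} \<subseteq> F then - ((- 1) ^ (k - card F)) else 0)"
proof -
  let ?V = "{0..k}" and ?A = "F \<union> {0..i}"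
  let ?f = "\<lambda>H. (- 1) ^ card (H - F) :: int"
  have FV: "F \<subseteq> ?V" "F \<noteq> ?V" and AV: "?A \<subseteq> ?V"
    using ik F by (auto simp: mem_shelling_complex)
  have fin: "finite {H. F \<subseteq> H \<and> H \<subseteq> ?V}" by (rule finite_subset[of _ "Pow ?V"]) auto
  have "(\<Sum>H | F \<subseteq> H \<and> H \<subseteq> ?V. ?f H) =
    (\<Sum>H | ?A \<subseteq> H \<and> H \<subseteq> ?V. ?f H) + (\<Sum>H | H \<in> shelling_complex k i \<and> F \<subseteq> H. ?f H)"
    using ik fin
    by (subst sum.union_disjoint[symmetric])
      (auto simp: mem_shelling_complex intro!: sum.cong elim: finite_subset[rotated])
  then have "link_reduced_euler (shelling_complex k i) F = (\<Sum>H | ?A \<subseteq> H \<and> H \<subseteq> ?V. ?f H)"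
    using FV sum_alternating_interval[of ?V F] by (simp add: link_reduced_euler_def sum_negf)
  also have "\<dots> = (\<Sum>H | ?A \<subseteq> H \<and> H \<subseteq> ?V. (- 1) ^ card (?A - F) * (- 1) ^ card (H - ?A))"
  proof (rule sum.cong[OF refl])
    fix H assume H: "H \<in> {H. ?A \<subseteq> H \<and> H \<subseteq> ?V}"
    then have "finite H" "finite F" using FV by (auto intro: finite_subset)
    moreover have "H - F = (?A - F) \<union> (H - ?A)" using H by auto
    ultimately have "card (H - F) = card (?A - F) + card (H - ?A)"
      by (simp only:) (rule card_Un_disjoint, auto)
    then show "?f H = (- 1) ^ card (?A - F) * (- 1) ^ card (H - ?A)" by (simp add: power_add)
  qed
  also have "\<dots> = (- 1) ^ card (?A - F) * (if ?A = ?V then 1 else 0)"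
    using sum_alternating_interval[of ?V ?A] AV by (simp add: sum_distrib_left[symmetric])
  also have "\<dots> = (if {i+1..k} \<subseteq> F then - ((- 1) ^ (k - card F)) else 0)"
  proof (cases "{i+1..k} \<subseteq> F")
    case True
    have A: "?A = ?V"
    proof
      show "?V \<subseteq> ?A" using True by (auto simp: subset_iff not_le Suc_le_eq)
    qed (rule AV)
    have "card (?A - F) = k + 1 - card F"
      unfolding A using FV by (subst card_Diff_subset) (auto intro: finite_subset)
    moreover have "card F \<le> k" using card_shelling_complex[OF ik F] .
    \<comment> \<open>The sole remaining set is \<open>?V\<close>; its exponent
      \<open>k + 1 - card F\<close> produces the minus sign.\<close>
    ultimately show ?thesis using True A by (simp add: Suc_diff_le)
  next
    case False
    then have "?A \<noteq> ?V" by fastforce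
    then show ?thesis using False by simp
  qed
  finally show ?thesis .
qed

section \<open>Explicit sums for the shelling components\<close>

lemma Psi_semi_eq:
  assumes ik: "i \<le> k" and kn: "k \<le> n"
  shows "Psi_semi n k i =
    (\<Sum>F\<in>shelling_complex k i. boolean_prefix (card F) * cap_a (n - card F)) -
    of_int ((- 1) ^ (n - k)) *
      (\<Sum>F | {i+1..k} \<subseteq> F \<and> F \<subset> {0..k}. boolean_prefix (card F) * cap_b (n - card F))"
proof -
  let ?\<Delta> = "shelling_complex k i"
  let ?g = "\<lambda>F. boolean_prefix (card F) * cap_b (n - card F)"
  have \<Delta>: "simplicial_complex ?\<Delta>" by (rule simplicial_complex_shelling_complex)
  have dim: "\<forall>F\<in>?\<Delta>. card F \<le> n" using card_shelling_complex[OF ik] kn by (meson le_trans)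
  have "(\<Sum>F\<in>?\<Delta>. of_int ((- 1) ^ (n - card F) * link_reduced_euler ?\<Delta> F) * ?g F) =
    (\<Sum>F\<in>?\<Delta>. if {i+1..k} \<subseteq> F then - of_int ((- 1) ^ (n - k)) * ?g F else 0)"
  proof (rule sum.cong[OF refl])
    fix F assume F: "F \<in> ?\<Delta>"
    have "card F \<le> k" using card_shelling_complex[OF ik F] .
    \<comment> \<open>The two exponents together have the parity of \<open>n - k\<close>, so the
      sign does not depend on \<open>F\<close>.\<close>
    then have "n - card F + (k - card F) = (n - k) + 2 * (k - card F)" using kn by simp
    then have "(- 1) ^ (n - card F) * (- 1) ^ (k - card F) = ((- 1) ^ (n - k) :: int)"
      by (metis mult.commute mult_1 power_add power_minus1_even)
    then have "(- 1) ^ (n - card F) * link_reduced_euler ?\<Delta> F =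
      (if {i+1..k} \<subseteq> F then - ((- 1) ^ (n - k)) else 0)"
      by (simp add: link_reduced_euler_shelling_complex[OF ik F])
    then show "of_int ((- 1) ^ (n - card F) * link_reduced_euler ?\<Delta> F) * ?g F =
      (if {i+1..k} \<subseteq> F then - of_int ((- 1) ^ (n - k)) * ?g F else 0)"
      by (simp only:) simp
  qed
  also have "\<dots> = - of_int ((- 1) ^ (n - k)) * (\<Sum>F | F \<in> ?\<Delta> \<and> {i+1..k} \<subseteq> F. ?g F)"
    using \<Delta> by (simp only: sum_distrib_left)
      (rule sum.inter_filter[symmetric], simp add: simplicial_complex_def)
  \<comment> \<open>A subset of the simplex containing all vertices after \<open>i\<close> omits one
    of \<open>0..i\<close> exactly when it is proper.\<close>
  also have "{F. F \<in> ?\<Delta> \<and> {i+1..k} \<subseteq> F} = {F. {i+1..k} \<subseteq> F \<and> F \<subset> {0..k}}"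
  proof -
    have "{i+1..k} \<subseteq> F \<Longrightarrow> {0..i} \<subseteq> F \<Longrightarrow> {0..k} \<subseteq> F" for F
      by (simp add: subset_iff Suc_le_eq) (meson not_le)
    then show ?thesis using ik by (auto simp: mem_shelling_complex)
  qed
  finally show ?thesis by (simp add: Psi_semi_def ab_index_semi_caps[OF \<Delta> dim])
qed

text \<open>Adding the facet opposite \<open>i\<close> adds the faces that contain all vertices
  before \<open>i\<close> but not \<open>i\<close>. On the Euler side the condition
  \<open>{i..k} \<subseteq> F\<close> weakens to \<open>{i+1..k} \<subseteq> F\<close>, so the new
  sets are those avoiding \<open>i\<close>. For \<open>i = 0\<close> nothing is subtracted, and the
  index itself already has this form.\<close>

lemma Phi_check_eq_interval_sums:
  assumes ik: "i \<le> k" and kn: "k \<le> n"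
  shows "Phi_check n k i =
    (\<Sum>F | {0..<i} \<subseteq> F \<and> F \<subseteq> {0..k} - {i}. boolean_prefix (card F) * cap_a (n - card F)) -
    of_int ((- 1) ^ (n - k)) *
      (\<Sum>F | {i+1..k} \<subseteq> F \<and> F \<subseteq> {0..k} - {i}. boolean_prefix (card F) * cap_b (n - card F))"
proof (cases i)
  case 0
  have "shelling_complex k i = {F. {0..<i} \<subseteq> F \<and> F \<subseteq> {0..k} - {i}}"
    using 0 by (auto simp: shelling_complex_def)
  moreover have "{F. {i+1..k} \<subseteq> F \<and> F \<subset> {0..k}} = {F. {i+1..k} \<subseteq> F \<and> F \<subseteq> {0..k} - {i}}"
  proof -
    have "{0..k} = insert 0 {1..k}" by auto
    then show ?thesis using 0 by auto
  qed
  ultimately show ?thesis using Psi_semi_eq[OF assms] 0 by (simp add: Phi_check_def)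
next
  case (Suc j)
  then have jk: "j \<le> k" using ik by simp
  let ?f = "\<lambda>F. boolean_prefix (card F) * cap_a (n - card F)"
  let ?g = "\<lambda>F. boolean_prefix (card F) * cap_b (n - card F)"
  let ?I = "{F. {0..<i} \<subseteq> F \<and> F \<subseteq> {0..k} - {i}}"
  let ?J = "{F. {i+1..k} \<subseteq> F \<and> F \<subseteq> {0..k} - {i}}"
  have fin: "finite {F. P F \<and> F \<subset> {0..k}}" "finite {F. P F \<and> F \<subseteq> {0..k} - {i}}" for P
    by (rule finite_subset[of _ "Pow {0..k}"]; auto)+
  have "{0..i} = insert i {0..<i}" "{0..j} = {0..<i}" using Suc by auto
  note ij = this
  have "shelling_complex k i = shelling_complex k j \<union> ?I"
    using ij ik jk by (intro set_eqI) (simp add: mem_shelling_complex, blast)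
  moreover have "(\<Sum>F\<in>shelling_complex k j \<union> ?I. ?f F) =
      (\<Sum>F\<in>shelling_complex k j. ?f F) + (\<Sum>F\<in>?I. ?f F)"
  proof (rule sum.union_disjoint)
    show "finite (shelling_complex k j)"
      using simplicial_complex_shelling_complex by (auto simp: simplicial_complex_def)
    show "shelling_complex k j \<inter> ?I = {}" using ij(2) jk by (auto simp: mem_shelling_complex)
  qed (rule fin(2))
  moreover have "{F. {i+1..k} \<subseteq> F \<and> F \<subset> {0..k}} = {F. {j+1..k} \<subseteq> F \<and> F \<subset> {0..k}} \<union> ?J"
  proof -
    have "{j+1..k} = insert i {i+1..k}" using Suc ik by auto
    then show ?thesis using ik by auto
  qed
  moreover have "(\<Sum>F\<in>{F. {j+1..k} \<subseteq> F \<and> F \<subset> {0..k}} \<union> ?J. ?g F) =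
      (\<Sum>F | {j+1..k} \<subseteq> F \<and> F \<subset> {0..k}. ?g F) + (\<Sum>F\<in>?J. ?g F)"
    using ik Suc by (intro sum.union_disjoint fin) auto
  ultimately show ?thesis
    using Psi_semi_eq[OF assms] Psi_semi_eq[OF jk kn] Suc
    by (simp add: Phi_check_def distrib_left)
qed

text \<open>Both intervals end at the \<open>k\<close>-element set \<open>{0..k} - {i}\<close> and
  start at sets of sizes \<open>i\<close> and \<open>k - i\<close>, so
  \<open>sum_card_interval\<close> applies.\<close>

lemma Phi_check_eq:
  assumes ik: "i \<le> k" and kn: "k \<le> n"
  shows "Phi_check n k i =
    (\<Sum>s\<le>k - i. of_nat ((k - i) choose s) * (boolean_prefix (i + s) * cap_a (n - (i + s)))) -
    of_int ((- 1) ^ (n - k)) * (\<Sum>s\<le>i. of_nat (i choose s) *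
      (boolean_prefix (k - i + s) * cap_b (n - (k - i + s))))"
proof -
  have "card ({0..k} - {i}) = k" "{0..<i} \<subseteq> {0..k} - {i}" "{i+1..k} \<subseteq> {0..k} - {i}"
    using ik by auto
  then show ?thesis
    using ik sum_card_interval[of "{0..k} - {i}" "{0..<i}" "\<lambda>s. boolean_prefix s * cap_a (n - s)"]
      sum_card_interval[of "{0..k} - {i}" "{i+1..k}" "\<lambda>s. boolean_prefix s * cap_b (n - s)"]
    by (simp add: Phi_check_eq_interval_sums[OF assms])
qed

section \<open>The derivation on the building blocks\<close>

lemma G_sum: "G (sum f A) = (\<Sum>x\<in>A. G (f x))"
  by (induction A rule: infinite_finite_induct) (simp_all add: G_add)

lemma G_one [simp]: "G 1 = 0"
  using G_mult[of 1 1] by simp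

lemma G_of_int_mult: "G (of_int j * p) = of_int j * G p"
proof -
  have nat: "G (of_nat m) = 0" for m by (induction m) (simp_all add: G_add)
  have "G (of_int j) = 0"
    using G_diff[of 0 1] by (cases j) (simp_all add: nat G_diff)
  then show ?thesis by (simp add: G_mult)
qed

lemma G_of_nat_mult: "G (of_nat m * p) = of_nat m * G p"
  using G_of_int_mult[of "int m"] by simp

text \<open>\<open>G\<close> and the commutator with \<open>b\<close> are both derivations, and they
  agree on \<open>e\<close> since \<open>ba - ab = be - eb\<close>.\<close>

lemma G_power_var_e: "G (var_e ^ m) = var_b * var_e ^ m - var_e ^ m * var_b"
proof (induction m)
  case (Suc m)
  have "G var_e = var_b * var_e - var_e * var_b"
    by (simp add: G_diff G_var_a G_var_b left_diff_distrib right_diff_distrib)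
  then show ?case
    by (simp only: power_Suc G_mult Suc)
      (simp add: left_diff_distrib right_diff_distrib mult.assoc)
qed simp

text \<open>The commutator term \<open>- e^m b b\<close> merges with
  \<open>e^m G(b) = e^m a b\<close> into \<open>e^(m+1) b\<close>.\<close>

lemma G_power_var_e_mult_var_b:
  "G (var_e ^ m * var_b) = var_b * var_e ^ m * var_b + var_e ^ Suc m * var_b"
  by (simp only: G_mult G_power_var_e G_var_b power_Suc2 left_diff_distrib mult.assoc)
    (simp add: left_diff_distrib right_diff_distrib)

text \<open>The commutator term \<open>- e^m b a\<close> cancels against
  \<open>e^m G(a)\<close>.\<close>

lemma G_power_var_e_mult_var_a: "G (var_e ^ m * var_a) = var_b * var_e ^ m * var_a"
  by (simp add: G_mult G_power_var_e G_var_a left_diff_distrib mult.assoc)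

text \<open>Pascal's rule, in the shape that \<open>G\<close> produces: a term at \<open>s\<close>
  spreads to \<open>s\<close> and \<open>s + 1\<close>.\<close>

lemma sum_choose_Suc:
  fixes f :: "nat \<Rightarrow> abpoly"
  shows "(\<Sum>s\<le>m. of_nat (m choose s) * (f (Suc s) + f s)) = (\<Sum>s\<le>Suc m. of_nat (Suc m choose s) * f s)"
proof -
  have "(\<Sum>s\<le>Suc m. of_nat (Suc m choose s) * f s) =
    f 0 + (\<Sum>s\<le>m. of_nat (m choose s) * f (Suc s)) + (\<Sum>s\<le>m. of_nat (m choose Suc s) * f (Suc s))"
    by (subst sum.atMost_Suc_shift) (simp add: distrib_right sum.distrib)
  also have "f 0 + (\<Sum>s\<le>m. of_nat (m choose s) * f (Suc s)) + (\<Sum>s\<le>m. of_nat (m choose Suc s) * f (Suc s))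
    = (\<Sum>s\<le>m. of_nat (m choose s) * f (Suc s)) + (\<Sum>s\<le>Suc m. of_nat (m choose s) * f s)"
    by (subst sum.atMost_Suc_shift[of "\<lambda>s. of_nat (m choose s) * f s"]) simp
  finally show ?thesis by (simp add: distrib_left sum.distrib binomial_eq_0)
qed

text \<open>Apply \<open>G\<close> to the recursion for \<open>boolean_prefix r\<close>. In each
  summand the correction from the induction hypothesis cancels against the commutator with
  \<open>b\<close>, leaving two neighbouring summands of the recursion for \<open>Suc r\<close>,
  which Pascal's rule assembles.\<close>

lemma G_boolean_prefix: "G (boolean_prefix r) = boolean_prefix (Suc r) - boolean_prefix r * var_b"
proof (induction r rule: less_induct)
  case (less r)
  show ?case
  proof (cases "r = 0")
    case True
    then show ?thesis by (simp add: boolean_prefix_def boolean_index_rec)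
  next
    case False
    let ?h = "\<lambda>s. boolean_prefix s * (var_e ^ (r - s) * var_b)"
    have summand: "G (boolean_prefix s * (var_e ^ (r - s - 1) * var_b)) = ?h (Suc s) + ?h s"
      if "s < r" for s
    proof -
      have eq: "r - s = Suc (r - s - 1)" using that by simp
      have "G (boolean_prefix s * (var_e ^ (r - s - 1) * var_b)) =
        boolean_prefix (Suc s) * (var_e ^ (r - s - 1) * var_b) +
        boolean_prefix s * (var_e ^ Suc (r - s - 1) * var_b)"
        by (simp only: G_mult[of "boolean_prefix s"] less.IH[OF that] G_power_var_e_mult_var_b)
          (simp add: left_diff_distrib distrib_left mult.assoc del: power_Suc)
      then show ?thesis by (simp only: eq[symmetric]) (simp add: Suc_diff_Suc that)
    qed
    \<comment> \<open>Pascal's rule requires the missing term \<open>s = r\<close>. Of its two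
      parts, \<open>?h (Suc r)\<close>, with truncated exponent 0, reappears on the right and
      cancels; \<open>?h r\<close> is the correction in the claim.\<close>
    have "(\<Sum>s<r. of_nat (r choose s) * (?h (Suc s) + ?h s)) + (?h (Suc r) + ?h r) =
      (\<Sum>s\<le>r. of_nat (r choose s) * (?h (Suc s) + ?h s))"
      by (simp add: lessThan_Suc_atMost[symmetric])
    also have "\<dots> = (\<Sum>s<Suc r. of_nat (Suc r choose s) * ?h s) + ?h (Suc r)"
      by (simp only: sum_choose_Suc[of r ?h]) (simp add: lessThan_Suc_atMost[symmetric])
    also have "(\<Sum>s<Suc r. of_nat (Suc r choose s) * ?h s) = boolean_prefix (Suc r)"
      by (subst boolean_prefix_rec) simp_all
    finally have "(\<Sum>s<r. of_nat (r choose s) * (?h (Suc s) + ?h s)) =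
      boolean_prefix (Suc r) - boolean_prefix r * var_b"
      by (simp add: eq_diff_eq add.commute)
    moreover have "G (boolean_prefix r) = (\<Sum>s<r. of_nat (r choose s) * (?h (Suc s) + ?h s))"
      unfolding boolean_prefix_rec[OF False[unfolded neq0_conv]] G_sum G_of_nat_mult
      by (intro sum.cong refl) (simp only: summand lessThan_iff)
    ultimately show ?thesis by simp
  qed
qed

text \<open>For \<open>m > 0\<close> the correction from \<open>G_boolean_prefix\<close> cancels
  against \<open>G (cap_a m)\<close>; for \<open>m = 0\<close>, \<open>G\<close> kills
  \<open>cap_a 0 = 1\<close> and the correction survives.\<close>

lemma G_boolean_prefix_cap_a:
  "G (boolean_prefix s * cap_a m) =
    boolean_prefix (Suc s) * cap_a m - (if m = 0 then boolean_prefix s * var_b else 0)"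
  by (simp add: cap_a_def G_mult[of "boolean_prefix s"] G_boolean_prefix G_power_var_e_mult_var_a
      left_diff_distrib mult.assoc)

text \<open>For \<open>m = 0\<close> the left side is 0, and the subtracted term compensates
  \<open>cap_b 1 = var_b\<close>.\<close>

lemma G_boolean_prefix_cap_b:
  "G (boolean_prefix s * cap_b m) = boolean_prefix (Suc s) * cap_b m +
    boolean_prefix s * cap_b (Suc m) - (if m = 0 then boolean_prefix s * var_b else 0)"
proof (cases m)
  case (Suc l)
  then show ?thesis
    by (simp add: cap_b_def G_mult[of "boolean_prefix s"] G_boolean_prefix G_power_var_e_mult_var_b
        left_diff_distrib distrib_left mult.assoc del: power_Suc)
qed (simp add: cap_b_def)

text \<open>
  For \<open>n = k\<close> the facets contribute \<open>m = 0\<close> terms to both sums; their corrections cancel.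
\<close>

lemma G_Phi_check:
  assumes ik: "i \<le> k" and kn: "k \<le> n"
  shows "G (Phi_check n k i) = Phi_check (n + 1) (k + 1) (i + 1)"
proof -
  let ?c = "if n = k then boolean_prefix k * var_b else 0"
  \<comment> \<open>The \<open>cap_b\<close> summand for \<open>(n+1, k+1, i+1)\<close>, as
    \<open>(k+1) - (i+1) = k - i\<close>.\<close>
  let ?h = "\<lambda>s. boolean_prefix (k - i + s) * cap_b (Suc n - (k - i + s))"
  \<comment> \<open>Here no Pascal step is required: raising all three parameters by one preserves
    \<open>k - i\<close> and the argument of \<open>cap_a\<close>. That argument can be 0 only at
    \<open>s = k - i\<close>.\<close>
  have "G (\<Sum>s\<le>k - i. of_nat ((k - i) choose s) * (boolean_prefix (i + s) * cap_a (n - (i + s)))) =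
    (\<Sum>s\<le>k - i. of_nat ((k - i) choose s) * (boolean_prefix (Suc (i + s)) * cap_a (n - (i + s))) -
      (if s = k - i then ?c else 0))"
    unfolding G_sum G_of_nat_mult G_boolean_prefix_cap_a
    using ik kn by (intro sum.cong refl) (auto simp: right_diff_distrib)
  also have "\<dots> = (\<Sum>s\<le>k - i. of_nat ((k - i) choose s) *
      (boolean_prefix (Suc (i + s)) * cap_a (n - (i + s)))) - ?c"
    by (simp add: sum_subtractf)
  finally have A: "G (\<Sum>s\<le>k - i. of_nat ((k - i) choose s) *
      (boolean_prefix (i + s) * cap_a (n - (i + s)))) = \<dots>" .
  have "G (\<Sum>s\<le>i. of_nat (i choose s) * (boolean_prefix (k - i + s) * cap_b (n - (k - i + s)))) =
    (\<Sum>s\<le>i. of_nat (i choose s) * (?h (Suc s) + ?h s) - (if s = i then ?c else 0))"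
    unfolding G_sum G_of_nat_mult G_boolean_prefix_cap_b
    using ik kn by (intro sum.cong refl) (auto simp: right_diff_distrib Suc_diff_le)
  also have "\<dots> = (\<Sum>s\<le>Suc i. of_nat (Suc i choose s) * ?h s) - ?c"
    by (simp only: sum_subtractf sum_choose_Suc[of i ?h]) simp
  finally have B: "G (\<Sum>s\<le>i. of_nat (i choose s) *
      (boolean_prefix (k - i + s) * cap_b (n - (k - i + s)))) = \<dots>" .
  \<comment> \<open>\<open>?c\<close> can be nonzero only for \<open>n = k\<close>, where the sign
    is 1.\<close>
  have C: "of_int ((- 1) ^ (n - k)) * ?c = ?c" by simp
  show ?thesis
    using ik kn C
    by (simp only: Phi_check_eq[OF assms] Phi_check_eq[of "i + 1" "k + 1" "n + 1"] G_diff
        G_of_int_mult A B right_diff_distrib)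
      simp
qed

section \<open>The boundary conditions\<close>

text \<open>For \<open>m \<ge> 1\<close> the four chains, with the 1 in \<open>zeta\<close> from
  \<open>OP\<close> to \<open>OC\<close>, give \<open>(e + b) e^(m-1) (e + b) = a e^(m-1) a\<close>;
  the sign in that \<open>zeta\<close> gives the other term.\<close>

lemma ab_index_omega:
  "ab_index (omega (Suc m)) =
    (if m = 0 then var_c
     else var_a * var_e ^ (m - 1) * var_a - of_int ((- 1) ^ m) * (var_b * var_e ^ (m - 1) * var_b))"
proof -
  define P where "P = omega (Suc m)"
  have qg: "quasi_graded_poset P" "is_min P OBot" "is_max P OTop"
    by (simp_all add: P_def omega_quasi_graded)
  have pm: "pmin P = OBot" "pmax P = OTop" using qg by (simp_all add: pmin_eq pmax_eq)
  have min: "is_min P (pmin P)" using qg pm by simp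
  note rec = index_to_rec[OF qg(1) min]
  have bot: "prefix_index P OBot = 1" by (simp add: prefix_index_def pm)
  have elems: "OP \<in> elems P" "OC \<in> elems P" "OTop \<in> elems P"
    and rks: "rk P OBot = 0" "rk P OP = 1" "rk P OC = Suc m" "rk P OTop = Suc (Suc m)"
    and zetas: "zeta P OBot x = 1" "zeta P x OTop = 1" "zeta P OP OC = 1 + (- 1) ^ Suc m" for x
    by (simp_all add: P_def omega_def)
  have below: "{x\<in>elems P. lt P x OP} = {OBot}"
    "{x\<in>elems P. lt P x OC} = (if m = 0 then {OBot} else {OBot, OP})"
    "{x\<in>elems P. lt P x OTop} = {OBot, OP, OC}"
    by (auto simp: P_def omega_def lt_def)
  have "index_to P OP = 1"
    using rec[of OP] by (simp add: below(1) elems rks zetas pm bot)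
  then have p: "prefix_index P OP = var_b" by (simp add: prefix_index_def pm)
  have c: "prefix_index P OC = var_e ^ m * var_b +
    (if m = 0 then 0 else of_int (1 + (- 1) ^ Suc m) * (var_b * var_e ^ (m - 1) * var_b))"
  proof -
    have "index_to P OC = var_e ^ m +
        (if m = 0 then 0 else var_b * (of_int (1 + (- 1) ^ Suc m) * var_e ^ (m - 1)))"
      using rec[of OC] by (simp add: below(2) elems rks zetas pm bot p del: power_Suc)
    then have "prefix_index P OC = var_e ^ m * var_b +
        (if m = 0 then 0
         else (var_b * of_int (1 + (- 1) ^ Suc m)) * var_e ^ (m - 1) * var_b)"
      by (simp add: prefix_index_def pm distrib_right mult.assoc del: power_Suc)
    then show ?thesis by (simp only: mult_of_int_commute[symmetric] mult.assoc)
  qed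
  have "ab_index P = var_e ^ Suc m + var_b * var_e ^ m + prefix_index P OC"
    unfolding ab_index_eq_index_to pm
    using rec[of OTop] by (simp add: below(3) elems rks zetas pm bot p add.assoc)
  \<comment> \<open>Powers of \<open>e\<close> commute with \<open>a - b\<close>, which moves
    \<open>a\<close> to the left.\<close>
  moreover have "var_e ^ l * var_a = var_a * var_e ^ l - var_b * var_e ^ l + var_e ^ l * var_b" for l
    using power_commutes[of var_e l] by (simp add: left_diff_distrib right_diff_distrib diff_eq_eq)
  ultimately show ?thesis unfolding c P_def[symmetric]
    by (cases m) (simp_all add: var_c_def left_diff_distrib right_diff_distrib distrib_left
        distrib_right mult.assoc)
qed

text \<open>For \<open>s < k\<close> the power \<open>e^(n-s-1)\<close> splits as
  \<open>e^(k-s-1) e^(n-k)\<close>, so these terms sum to a multiple of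
  \<open>boolean_index k\<close>; the terms with \<open>s = k\<close> carry this left factor through
  \<open>boolean_prefix k\<close>. The right factors add up to the index of
  \<open>omega\<close>.\<close>

lemma Phi_check_boundary:
  assumes k: "1 \<le> k" and kn: "k \<le> n"
  shows "Phi_check n k 0 = ab_index (boolean_algebra_poset k) * ab_index (omega (n - k + 1))"
proof -
  let ?B = "boolean_index k"
  have W: "boolean_prefix k = ?B * var_b" using k by (simp add: boolean_prefix_def)
  have "(\<Sum>s<k. of_nat (k choose s) * (boolean_prefix s * cap_a (n - s))) =
    (\<Sum>s<k. of_nat (k choose s) * (boolean_prefix s * var_e ^ (k - s - 1))) * (var_e ^ (n - k) * var_a)"
    unfolding sum_distrib_right
  proof (rule sum.cong[OF refl])
    fix s assume "s \<in> {..<k}"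
    then have "n - s - 1 = (k - s - 1) + (n - k)" "n - s \<noteq> 0" using kn by auto
    then have "cap_a (n - s) = var_e ^ (k - s - 1) * (var_e ^ (n - k) * var_a)"
      by (simp only: cap_a_def power_add if_False mult.assoc)
    then show "of_nat (k choose s) * (boolean_prefix s * cap_a (n - s)) =
      of_nat (k choose s) * (boolean_prefix s * var_e ^ (k - s - 1)) * (var_e ^ (n - k) * var_a)"
      by (simp only: mult.assoc)
  qed
  also have "\<dots> = ?B * (var_e ^ (n - k) * var_a)" by (simp only: boolean_index_rec[symmetric])
  finally have "Phi_check n k 0 = ?B * (var_e ^ (n - k) * var_a) + ?B * var_b * cap_a (n - k) -
      of_int ((- 1) ^ (n - k)) * (?B * var_b * cap_b (n - k))"
    using kn by (simp add: Phi_check_eq W lessThan_Suc_atMost[symmetric])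
  also have "\<dots> = ?B * ab_index (omega (n - k + 1))"
  proof (cases "n - k")
    case (Suc m)
    define j :: int where "j = (- 1) ^ Suc m"
    have "var_a * var_e ^ m * var_a = var_e ^ Suc m * var_a + var_b * (var_e ^ m * var_a)"
      by (simp add: left_diff_distrib mult.assoc)
    moreover have "?B * (of_int j * p) = of_int j * (?B * p)" for p
      by (metis mult.assoc mult_of_int_commute)
    ultimately show ?thesis unfolding Suc Suc_eq_plus1[symmetric] ab_index_omega j_def[symmetric]
      by (simp add: cap_a_def cap_b_def distrib_left right_diff_distrib mult.assoc del: power_Suc)
  qed (simp_all add: ab_index_omega cap_a_def cap_b_def var_c_def distrib_left)
  finally show ?thesis using k by (simp add: ab_index_boolean_algebra)
qed

text \<open>Here \<open>c^2 - 2d = e^2\<close>. Only the empty face contributes, and for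
  \<open>n \<ge> 1\<close> the sign turns the last factor after \<open>e^(n-1)\<close> into
  \<open>a - b\<close> or \<open>a + b\<close>.\<close>

lemma Phi_check_zero:
  "Phi_check n 0 0 =
    (if even n then (var_c ^ 2 - 2 * var_d) ^ (n div 2)
     else (var_c ^ 2 - 2 * var_d) ^ ((n - 1) div 2) * var_c)"
proof -
  have cd: "var_c ^ 2 - 2 * var_d = var_e ^ 2"
    by (simp add: var_c_def var_d_def power2_eq_square mult_2 distrib_left distrib_right left_diff_distrib
        right_diff_distrib)
  have Phi: "Phi_check n 0 0 = cap_a n - of_int ((- 1) ^ n) * cap_b n"
    by (simp add: Phi_check_eq boolean_prefix_def)
  show ?thesis
  proof (cases n)
    case (Suc m)
    have "even n \<Longrightarrow> 2 * (n div 2) = Suc m" "odd n \<Longrightarrow> 2 * ((n - 1) div 2) = m"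
      using Suc by auto
    then show ?thesis unfolding cd power_mult[symmetric] using Suc
      by (cases "even n") (simp_all add: Phi[unfolded Suc] cap_a_def cap_b_def var_c_def
          power_Suc2 left_diff_distrib right_diff_distrib distrib_left del: power_Suc)
  qed (use Phi in \<open>simp add: cap_a_def cap_b_def\<close>)
qed

theorem theorem14p2:
  shows "(\<forall>n k i. i \<le> k \<and> k \<le> n \<longrightarrow>
            G (Phi_check n k i) = Phi_check (n + 1) (k + 1) (i + 1)) \<and>
         (\<forall>n k. 1 \<le> k \<and> k \<le> n \<longrightarrow>
            Phi_check n k 0 =
              ab_index (boolean_algebra_poset k) * ab_index (omega (n - k + 1))) \<and>
         (\<forall>n. Phi_check n 0 0 =
            (if even n then (var_c ^ 2 - 2 * var_d) ^ (n div 2)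
             else (var_c ^ 2 - 2 * var_d) ^ ((n - 1) div 2) * var_c))"
  using G_Phi_check Phi_check_boundary Phi_check_zero by blast

end
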